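(* Let $n \ge 2$ be an integer. There exists an exponential orthomorphism modulo $n$ if and only if $n = 2$, $n = 3$, $n = 4$, or $n = 2p$ where $p$ is an odd prime such that $p - 1 = 2 q_1 q_2 \cdots q_k$ for some $k \ge 0$ and distinct odd primes $q_1, \dots, q_k$.
   Context: For an integer $n \ge 2$, an exponential orthomorphism modulo $n$ is a permutation $\sigma$ of $\{1, \dots, n-1\}$ such that the map $x \mapsto x^{\sigma(x)} \bmod n$ is also a bijection of $\{1, \dots, n-1\}$ (residues taken in $\{0,\dots,n-1\}$). *)

theory Defs
  imports "HOL-Computational_Algebra.Primes" "HOL-Combinatorics.Permutations"
begin

definition exponential_orthomorphism :: "nat \<Rightarrow> (nat \<Rightarrow> nat) \<Rightarrow> bool" where
  "exponential_orthomorphism n \<sigma> \<longleftrightarrow>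
     \<sigma> permutes {1..n - 1} \<and>
     bij_betw (\<lambda>x. x ^ \<sigma> x mod n) {1..n - 1} {1..n - 1}"

end

theory Submission
  imports Defs "HOL-Number_Theory.Number_Theory" "HOL-Computational_Algebra.Squarefree"
begin

text \<open>
  Write \<open>f x = x ^ \<sigma> x mod n\<close>. If \<open>r\<^sup>2\<close> divides \<open>n > 4\<close>, both \<open>r\<close> and \<open>n - r\<close> can only be hit by
  themselves with exponent 1. If two odd primes divide \<open>n\<close>, the values at points with even exponent
  are squares, and there are too few squares. So \<open>n = c p\<close> with \<open>c \<le> 2\<close>; take discrete logarithms
  modulo \<open>p\<close>. For a prime \<open>q\<close> dividing \<open>p - 1\<close>, a point whose logarithm is prime to \<open>q\<close> must have
  an exponent prime to \<open>q\<close>, and counting exponents leaves at most \<open>c - 1\<close> further exponents prime to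
  \<open>q\<close>; if \<open>q\<^sup>2\<close> divides \<open>p - 1\<close>, reaching the \<open>c\<close> lifts of the element with logarithm \<open>q\<close> needs
  \<open>c\<close> of them. For \<open>c = 1\<close> it follows that the logarithm and the exponent of
  \<open>x\<close> are divisible by the same prime factors \<open>q\<close> of \<open>p - 1\<close>. So for odd \<open>q\<close>, when \<open>x\<close> runs over the points with logarithm divisible by \<open>(p - 1) / q\<close> but not by \<open>q\<close>, the
  logarithms of \<open>x\<close>, the exponents, and the logarithms of \<open>f x\<close> run over the same residues, whose
  product is \<open>-1\<close> modulo \<open>q\<close> by Wilson; hence \<open>-1 = (-1)(-1)\<close>, a contradiction.

  Conversely, for \<open>n = 2 p\<close> the two parity classes allow two families of exponents modulo
  \<open>N = p - 1\<close>, each making \<open>a \<mapsto> a s(a)\<close> bijective, which together use every residue exactly twice.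
  Such pairs exist for prime \<open>N\<close> (by an explicit construction on logarithms) and are
  closed under products of coprime moduli; the one remaining exponent goes to the point \<open>p\<close>.
\<close>

subsection \<open>Discrete logarithms modulo a prime\<close>

locale primroot_mod_prime =
  fixes p g :: nat
  assumes p: "prime p" and g: "residue_primroot p g"
begin

lemma coprime_g: "coprime p g"
  using g by (simp add: residue_primroot_def)

lemma g_power_cong_iff: "[g ^ a = g ^ b] (mod p) \<longleftrightarrow> [a = b] (mod (p - 1))"
  using order_divides_expdiff[OF coprime_g, of a b] g p
  by (simp add: residue_primroot_def totient_prime)

lemma not_dvd_g_power: "\<not> p dvd g ^ a"
  using p coprime_g
  by (metis coprime_absorb_left not_prime_unit prime_dvd_power)

lemma ex_log: "\<not> p dvd x \<Longrightarrow> \<exists>a<p - 1. [g ^ a = x] (mod p)"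
proof -
  assume x: "\<not> p dvd x"
  have "x mod p \<in> totatives p"
    using x p by (auto simp: totatives_prime mod_greater_zero_iff_not_dvd prime_gt_0_nat)
  also have "totatives p = (\<lambda>i. g ^ i mod p) ` {..<totient p}"
    using residue_primroot_is_generator[OF prime_gt_1_nat[OF p] g] by (simp add: bij_betw_def)
  finally show ?thesis
    using p by (auto simp: totient_prime cong_def)
qed

text \<open>Choice makes the value depend only on the residue class of \<open>x\<close>, so
  \<open>lg_mod\<close> also holds at multiples of \<open>p\<close>, where no logarithm
  exists.\<close>

definition lg :: "nat \<Rightarrow> nat" where
  "lg x = (SOME a. a < p - 1 \<and> [g ^ a = x] (mod p))"

lemma lg_less: "\<not> p dvd x \<Longrightarrow> lg x < p - 1"
  and g_power_lg: "\<not> p dvd x \<Longrightarrow> [g ^ lg x = x] (mod p)"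
  using someI_ex[of "\<lambda>a. a < p - 1 \<and> [g ^ a = x] (mod p)"] ex_log[of x]
  unfolding lg_def by auto

lemma lg_unique:
  assumes "[g ^ a = x] (mod p)" shows "lg x = a mod (p - 1)"
proof -
  have x: "\<not> p dvd x"
    using assms not_dvd_g_power[of a] cong_dvd_iff by blast
  have "[g ^ lg x = g ^ a] (mod p)"
    using g_power_lg[OF x] assms by (metis cong_sym cong_trans)
  thus ?thesis
    using lg_less[OF x] unfolding g_power_cong_iff by (simp add: cong_def)
qed

lemma lg_power:
  assumes "\<not> p dvd x" shows "lg (x ^ s) = lg x * s mod (p - 1)"
  by (rule lg_unique) (simp add: power_mult cong_pow g_power_lg assms)

lemma lg_mult:
  assumes "\<not> p dvd x" "\<not> p dvd y" shows "lg (x * y) = (lg x + lg y) mod (p - 1)"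
  by (rule lg_unique) (simp add: power_add cong_mult g_power_lg assms)

lemma lg_g_power: "lg (g ^ a) = a mod (p - 1)"
  by (rule lg_unique) simp

lemma lg_eq_iff:
  assumes "\<not> p dvd x" "\<not> p dvd y" shows "lg x = lg y \<longleftrightarrow> [x = y] (mod p)"
proof
  assume "lg x = lg y"
  thus "[x = y] (mod p)"
    using g_power_lg[OF assms(1)] g_power_lg[OF assms(2)] by (metis cong_sym cong_trans)
next
  assume "[x = y] (mod p)"
  hence "[g ^ lg y = x] (mod p)"
    using g_power_lg[OF assms(2)] by (metis cong_sym cong_trans)
  thus "lg x = lg y"
    using lg_unique lg_less[OF assms(2)] by fastforce
qed

lemma lg_mod [simp]: "lg (x mod p) = lg x"
  by (simp add: lg_def cong_def)

lemma lg_mod_mult: "lg (x mod (c * p)) = lg x"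
  by (metis lg_mod mod_mult_right_eq mod_mod_cancel dvd_triv_right)

end

lemma ex_primroot_mod_prime: "prime p \<Longrightarrow> \<exists>g. primroot_mod_prime p g"
  using prime_primitive_root_exists[of p] prime_gt_1_nat[of p]
  by (auto simp: primroot_mod_prime_def)

subsection \<open>Balanced pairs of multipliers\<close>

text \<open>
  The multipliers \<open>s\<^sub>i(a) = snd (b (i, a))\<close> take each value exactly twice; the first component of
  \<open>b (i, a)\<close> only tells the two occurrences apart.
\<close>

definition balanced_multipliers :: "nat \<Rightarrow> (nat \<times> nat \<Rightarrow> nat \<times> nat) \<Rightarrow> bool" where
  "balanced_multipliers N b \<longleftrightarrow>
     bij_betw b ({..<2} \<times> {..<N}) ({..<2} \<times> {..<N}) \<and>
     (\<forall>i<2. inj_on (\<lambda>a. a * snd (b (i, a)) mod N) {..<N})"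

text \<open>Squaring is injective modulo 1 and 2, so both families may use \<open>a\<close> itself
  as its multiplier. The case 2 starts the later induction over odd primes.\<close>

lemma balanced_multipliers_le_2:
  assumes "N \<le> 2" shows "balanced_multipliers N id"
proof -
  have "N = 0 \<or> N = 1 \<or> N = 2" using assms by auto
  thus ?thesis
    unfolding balanced_multipliers_def by (auto simp: inj_on_def less_2_cases_iff)
qed

lemma balanced_multipliersI:
  assumes "b ` ({..<2} \<times> {..<N}) \<subseteq> {..<2} \<times> {..<N}" "inj_on b ({..<2} \<times> {..<N})"
    "\<And>i. i < 2 \<Longrightarrow> inj_on (\<lambda>a. a * snd (b (i, a)) mod N) {..<N}"
  shows "balanced_multipliers N b"
  unfolding balanced_multipliers_def using assms endo_inj_surj[OF _ assms(1,2)]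
  by (auto simp: bij_betw_def)

text \<open>The Chinese remainder theorem glues a multiplier modulo \<open>N\<close> to one modulo
  \<open>M\<close>. Chaining \<open>b\<close> and \<open>b'\<close> through the label keeps the
  combined map invertible.\<close>

lemma balanced_multipliers_coprime_mult:
  assumes co: "coprime N M" and N: "balanced_multipliers N b" and M: "balanced_multipliers M b'"
  shows "\<exists>b. balanced_multipliers (N * M) b"
proof (cases "N = 0 \<or> M = 0")
  case True
  thus ?thesis using balanced_multipliers_le_2[of "N * M"] by auto
next
  case False
  hence pos: "0 < N" "0 < M" by auto
  define crt where "crt = (\<lambda>v w. SOME z. z < N * M \<and> [z = v] (mod N) \<and> [z = w] (mod M))"
  have crt: "crt v w < N * M \<and> [crt v w = v] (mod N) \<and> [crt v w = w] (mod M)" for v w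
  proof -
    have "\<exists>z. z < N * M \<and> [z = v] (mod N) \<and> [z = w] (mod M)"
      using binary_chinese_remainder_unique_nat[OF co, of v w] pos by blast
    thus ?thesis unfolding crt_def by (rule someI_ex)
  qed
  have crt_mod: "crt v w mod N = v mod N" "crt v w mod M = w mod M" for v w
    using crt[of v w] by (auto simp: cong_def)
  have eqI: "x = y" if "x mod N = y mod N" "x mod M = y mod M" "x < N * M" "y < N * M" for x y
    using coprime_cong_mult_nat[of x y N M] co that
    by (intro cong_less_modulus_unique_nat[of x y "N * M"]) (auto simp: cong_def)
  \<comment> \<open>The label of the occurrence of a value modulo \<open>N\<close> selects the family used modulo \<open>M\<close>.\<close>
  define B where "B = (\<lambda>(i, x). let (j, v) = b (i, x mod N); (k, w) = b' (j, x mod M)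
                               in (k, crt v w))"
  have B: "B (i, x) = (fst (b' (fst (b (i, x mod N)), x mod M)),
      crt (snd (b (i, x mod N))) (snd (b' (fst (b (i, x mod N)), x mod M))))" for i x
    by (simp add: B_def Let_def split_beta)
  have b: "fst (b (i, x mod N)) < 2" "snd (b (i, x mod N)) < N" if "i < 2" for i x
  proof -
    have "b (i, x mod N) \<in> {..<2} \<times> {..<N}"
      using N pos that unfolding balanced_multipliers_def by (intro bij_betw_apply[of b]) auto
    thus "fst (b (i, x mod N)) < 2" "snd (b (i, x mod N)) < N"
      by (auto simp: mem_Times_iff)
  qed
  have b': "fst (b' (i, x mod M)) < 2" "snd (b' (i, x mod M)) < M" if "i < 2" for i x
  proof -
    have "b' (i, x mod M) \<in> {..<2} \<times> {..<M}"
      using M pos that unfolding balanced_multipliers_def by (intro bij_betw_apply[of b']) auto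
    thus "fst (b' (i, x mod M)) < 2" "snd (b' (i, x mod M)) < M"
      by (auto simp: mem_Times_iff)
  qed
  have bI: "i = j \<and> x mod N = y mod N"
    if "b (i, x mod N) = b (j, y mod N)" "i < 2" "j < 2" for i j x y
  proof -
    have "inj_on b ({..<2} \<times> {..<N})"
      using N by (simp add: balanced_multipliers_def bij_betw_def)
    from inj_onD[OF this that(1)] that pos show ?thesis by auto
  qed
  have bI': "i = j \<and> x mod M = y mod M"
    if "b' (i, x mod M) = b' (j, y mod M)" "i < 2" "j < 2" for i j x y
  proof -
    have "inj_on b' ({..<2} \<times> {..<M})"
      using M by (simp add: balanced_multipliers_def bij_betw_def)
    from inj_onD[OF this that(1)] that pos show ?thesis by auto
  qed
  have "balanced_multipliers (N * M) B"
  proof (rule balanced_multipliersI)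
    show "B ` ({..<2} \<times> {..<N * M}) \<subseteq> {..<2} \<times> {..<N * M}"
      using b b' crt by (auto simp: B)
    show "inj_on B ({..<2} \<times> {..<N * M})"
    proof (rule inj_onI)
      fix u w
      assume "u \<in> {..<2} \<times> {..<N * M}" "w \<in> {..<2} \<times> {..<N * M}" "B u = B w"
      then obtain i x j y where uw: "u = (i, x)" "w = (j, y)" and *: "B (i, x) = B (j, y)" "i \<in> {..<2}" "j \<in> {..<2}" "x \<in> {..<N * M}" "y \<in> {..<N * M}"
        by auto
      let ?c = "b (i, x mod N)" and ?d = "b (j, y mod N)"
      let ?c' = "b' (fst ?c, x mod M)" and ?d' = "b' (fst ?d, y mod M)"
      have less: "snd ?c < N" "snd ?d < N" "snd ?c' < M" "snd ?d' < M"
        using * b[of i x] b[of j y] b'[of "fst ?c" x] b'[of "fst ?d" y] by auto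
      have "fst ?c' = fst ?d'" and eq: "crt (snd ?c) (snd ?c') = crt (snd ?d) (snd ?d')"
        using *(1) by (auto simp: B)
      moreover have "snd ?c = snd ?d"
        using arg_cong[OF eq, of "\<lambda>z. z mod N"] less by (simp add: crt_mod)
      moreover have "snd ?c' = snd ?d'"
        using arg_cong[OF eq, of "\<lambda>z. z mod M"] less by (simp add: crt_mod)
      ultimately have "snd ?c = snd ?d" "?c' = ?d'"
        by (auto simp: prod_eq_iff)
      \<comment> \<open>Decoding runs backwards: inverting \<open>b'\<close> recovers the
        intermediate label, which completes the value of \<open>b\<close>, so \<open>b\<close> can
        be inverted next.\<close>
      hence "?c = ?d" "x mod M = y mod M"
        using bI'[of "fst ?c" x "fst ?d" y] b[of i x] b[of j y] * by (auto simp: prod_eq_iff)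
      moreover from this have "i = j" "x mod N = y mod N"
        using bI[of i x j y] * by auto
      ultimately show "u = w"
        using eqI * uw by auto
    qed
    fix i :: nat assume i: "i < 2"
    show "inj_on (\<lambda>x. x * snd (B (i, x)) mod (N * M)) {..<N * M}"
    proof (rule inj_onI)
      fix x y assume *: "x \<in> {..<N * M}" "y \<in> {..<N * M}"
        "x * snd (B (i, x)) mod (N * M) = y * snd (B (i, y)) mod (N * M)"
      have "x * snd (B (i, x)) mod N = y * snd (B (i, y)) mod N"
        using arg_cong[OF *(3), of "\<lambda>z. z mod N"] by (simp add: mod_mod_cancel)
      hence 1: "(x mod N) * snd (b (i, x mod N)) mod N = (y mod N) * snd (b (i, y mod N)) mod N"
        unfolding B snd_conv
        by (subst (asm) (1 2) mod_mult_eq[symmetric]) (simp add: crt_mod mod_mult_right_eq)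
      have "x * snd (B (i, x)) mod M = y * snd (B (i, y)) mod M"
        using arg_cong[OF *(3), of "\<lambda>z. z mod M"] by (simp add: mod_mod_cancel)
      hence 2: "(x mod M) * snd (b' (fst (b (i, x mod N)), x mod M)) mod M =
                (y mod M) * snd (b' (fst (b (i, y mod N)), y mod M)) mod M"
        unfolding B snd_conv
        by (subst (asm) (1 2) mod_mult_eq[symmetric]) (simp add: crt_mod mod_mult_right_eq)
      \<comment> \<open>The residues modulo \<open>N\<close> must be compared first: once they
        agree, \<open>x\<close> and \<open>y\<close> use the same family modulo
        \<open>M\<close>.\<close>
      have "x mod N = y mod N"
        using N i pos unfolding balanced_multipliers_def
        by (intro inj_onD[of "\<lambda>a. a * snd (b (i, a)) mod N" "{..<N}", OF _ 1]) auto
      moreover have "x mod M = y mod M"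
        using M b(1)[OF i, of y] pos unfolding balanced_multipliers_def
        by (intro inj_onD[of "\<lambda>a. a * snd (b' (fst (b (i, y mod N)), a)) mod M" "{..<M}",
              OF _ 2[unfolded \<open>x mod N = y mod N\<close>]]) auto
      ultimately show "x = y"
        using eqI * by auto
    qed
  qed
  thus ?thesis by blast
qed

text \<open>
  The additive solution modulo \<open>2 h\<close>: the first family takes the value 0 twice and misses \<open>h\<close>,
  the second one is its translate by \<open>h\<close>.
\<close>

definition balanced_shift :: "nat \<Rightarrow> nat \<times> nat \<Rightarrow> nat \<times> nat" where
  "balanced_shift h = (\<lambda>(i, c). (c div h, (c + i * h + c div h) mod (2 * h)))"

lemma balanced_shift_eq:
  assumes "i < 2" "c < 2 * h"
  shows "balanced_shift h (i, c) =
    (if c < h then (0, if i = 0 then c else c + h)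
     else (1, if i = 0 then (if c = 2 * h - 1 then 0 else c + 1) else c + 1 - h))"
proof -
  have h: "0 < h" using assms by simp
  show ?thesis
  proof (cases "c < h")
    case True
    thus ?thesis using assms by (auto simp: balanced_shift_def less_2_cases_iff)
  next
    case False
    hence d: "c div h = 1" using assms h by (intro div_nat_eqI) auto
    have "(c + i * h + 1) mod (2 * h) = c + 1 - h" if "i = 1"
      using that False assms mod_add_self2[of "c + 1 - h" "2 * h"] by (simp add: add.commute)
    moreover have "(c + i * h + 1) mod (2 * h) = (if c = 2 * h - 1 then 0 else c + 1)" if "i = 0"
      using that assms by auto
    ultimately show ?thesis using assms False d
      by (auto simp: balanced_shift_def less_2_cases_iff)
  qed
qed

text \<open>Under label 0 the two families cover the complementary halves \<open>{0..<h}\<close> and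
  \<open>{h..<2 * h}\<close>. Under label 1 they cover \<open>{1..h}\<close> (second family) and the
  remaining residues (first family).\<close>

lemma inj_on_balanced_shift: "inj_on (balanced_shift h) ({..<2} \<times> {..<2 * h})"
proof (rule inj_onI)
  fix u w assume *: "u \<in> {..<2} \<times> {..<2 * h}" "w \<in> {..<2} \<times> {..<2 * h}"
    "balanced_shift h u = balanced_shift h w"
  obtain i c j d where uw: "u = (i, c)" "w = (j, d)" by fastforce
  have less: "i < 2" "c < 2 * h" "j < 2" "d < 2 * h" using * uw by auto
  have eq: "balanced_shift h (i, c) = balanced_shift h (j, d)" using * uw by simp
  show "u = w" using less eq unfolding uw balanced_shift_eq[OF less(1,2)] balanced_shift_eq[OF less(3,4)]
    by (auto simp: less_2_cases_iff split: if_splits)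
qed

text \<open>The sum is \<open>2 * c + c div h + i * h\<close>. Doubling alone hits every even
  residue twice; \<open>c div h\<close> moves the upper half onto the odd residues, and
  \<open>i * h\<close> only translates.\<close>

lemma inj_on_add_balanced_shift:
  assumes "i < 2"
  shows "inj_on (\<lambda>c. (c + snd (balanced_shift h (i, c))) mod (2 * h)) {..<2 * h}"
proof -
  have *: "(c + snd (balanced_shift h (i, c))) mod (2 * h) = (2 * c + c div h + i * h) mod (2 * h)" for c
  proof -
    have "c + (c + i * h + c div h) = 2 * c + c div h + i * h" by simp
    thus ?thesis by (simp only: balanced_shift_def split_conv snd_conv mod_add_right_eq)
  qed
  have **: "[2 * c + c div h = 2 * d + d div h] (mod (2 * h))" 
    if "[2 * c + c div h + i * h = 2 * d + d div h + i * h] (mod (2 * h))" for c d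
    using that by (simp add: cong_add_rcancel_nat)
  have val: "(2 * c + c div h) mod (2 * h) = (if c < h then 2 * c else 2 * (c - h) + 1)" if "c < 2 * h" for c
  proof (cases "c < h")
    case False
    hence "c div h = 1" using that by (intro div_nat_eqI) auto
    moreover have "2 * c + 1 = 2 * (c - h) + 1 + 2 * h" using False by simp
    moreover have "2 * (c - h) + 1 < 2 * h" using that by simp
    ultimately show ?thesis using False by (metis mod_add_self2 mod_less)
  qed auto
  show ?thesis
  proof (rule inj_onI)
    fix c d assume cd: "c \<in> {..<2 * h}" "d \<in> {..<2 * h}"
      "(c + snd (balanced_shift h (i, c))) mod (2 * h) = (d + snd (balanced_shift h (i, d))) mod (2 * h)"
    hence "(2 * c + c div h) mod (2 * h) = (2 * d + d div h) mod (2 * h)"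
      using **[of c d] unfolding * cong_def by simp
    hence "(if c < h then 2 * c else 2 * (c - h) + 1) = (if d < h then 2 * d else 2 * (d - h) + 1)"
      using cd val by simp
    thus "c = d"
      by (auto split: if_splits) presburger+
  qed
qed

section \<open>Balanced pairs modulo odd primes and modulo twice their products\<close>

context primroot_mod_prime
begin

text \<open>Logarithms turn multiplication of nonzero residues into addition modulo
  \<open>p - 1 = 2 * h\<close>, where \<open>balanced_shift\<close> applies. The residue 0 receives
  multiplier 0 in both families, so the value 0 also occurs twice, once per label.\<close>

lemma ex_balanced_multipliers:
  assumes "odd p" shows "\<exists>b. balanced_multipliers p b"
proof -
  obtain h where h: "p - 1 = 2 * h" using assms by (metis dvdE odd_two_times_div_two_nat)
  define b where "b = (\<lambda>(i, x). if x = 0 then (i, 0) else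
    let (j, v) = balanced_shift h (i, lg x) in (j, g ^ v mod p))"
  have b0: "b (i, 0) = (i, 0)" for i by (simp add: b_def)
  have b: "b (i, x) = (fst (balanced_shift h (i, lg x)), g ^ snd (balanced_shift h (i, lg x)) mod p)"
    if "x \<noteq> 0" for i x using that by (simp add: b_def split_beta)
  have nd: "\<not> p dvd x" if "x < p" "x \<noteq> 0" for x
    using that by (auto dest: dvd_imp_le)
  have nd2: "\<not> p dvd snd (b (i, x))" if "x \<noteq> 0" for i x
    using not_dvd_g_power that by (simp add: b dvd_mod_iff)
  have lg_lt: "lg x < 2 * h" if "x < p" "x \<noteq> 0" for x
    using lg_less[OF nd[OF that]] h by simp
  have sh: "fst (balanced_shift h (i, lg x)) < 2 \<and> snd (balanced_shift h (i, lg x)) < 2 * h"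
    if "x < p" "x \<noteq> 0" "i < 2" for i x
    using lg_lt[OF that(1,2)] that by (auto simp: balanced_shift_eq less_2_cases_iff)
  have lgb: "lg (snd (b (i, x))) = snd (balanced_shift h (i, lg x))" if "x < p" "x \<noteq> 0" "i < 2" for i x
    using sh[OF that] that h by (simp add: b lg_g_power del: One_nat_def)
  have lg_inj: "x = y" if "lg x = lg y" "x < p" "x \<noteq> 0" "y < p" "y \<noteq> 0" for x y
    using lg_eq_iff[of x y] nd that by (simp add: cong_def)
  have ppos: "0 < p" using p prime_gt_0_nat by blast
  have "balanced_multipliers p b"
  proof (rule balanced_multipliersI)
    show "b ` ({..<2} \<times> {..<p}) \<subseteq> {..<2} \<times> {..<p}"
    proof (rule image_subsetI)
      fix u assume "u \<in> {..<2::nat} \<times> {..<p}"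
      then obtain i x where u: "u = (i, x)" and "i < 2" "x < p" by auto
      thus "b u \<in> {..<2} \<times> {..<p}"
        using sh[of x i] ppos unfolding u by (cases "x = 0") (auto simp: b0 b)
    qed
    show "inj_on b ({..<2} \<times> {..<p})"
    proof (rule inj_onI)
      fix u w assume *: "u \<in> {..<2} \<times> {..<p}" "w \<in> {..<2} \<times> {..<p}" "b u = b w"
      obtain i x j y where uw: "u = (i, x)" "w = (j, y)" by fastforce
      have less: "i < 2" "x < p" "j < 2" "y < p" and eq: "b (i, x) = b (j, y)" using * uw by auto
      have zero: "x = 0 \<longleftrightarrow> y = 0"
        using nd2[of x i] nd2[of y j] eq b0[of i] b0[of j] by (metis dvd_0_right snd_conv)
      show "u = w"
      proof (cases "x = 0")
        case False
        hence y: "y \<noteq> 0" using zero by simp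
        have "balanced_shift h (i, lg x) = balanced_shift h (j, lg y)"
          using lgb[of x i] lgb[of y j] b[of x i] b[of y j] False y less eq
          by (metis fst_conv prod_eqI)
        hence "i = j \<and> lg x = lg y"
          using inj_onD[OF inj_on_balanced_shift] lg_lt False y less by fastforce
        thus ?thesis using lg_inj False y less uw by auto
      qed (use zero eq uw b0 in auto)
    qed
    fix i :: nat assume i: "i < 2"
    show "inj_on (\<lambda>x. x * snd (b (i, x)) mod p) {..<p}"
    proof (rule inj_onI)
      fix x y assume *: "x \<in> {..<p}" "y \<in> {..<p}"
        "x * snd (b (i, x)) mod p = y * snd (b (i, y)) mod p"
      have nd3: "x * snd (b (i, x)) mod p = 0 \<longleftrightarrow> x = 0" if "x < p" for x
        using nd[OF that] nd2[of x i] p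
        by (auto simp: mod_eq_0_iff_dvd prime_dvd_mult_iff)
      have zero: "x = 0 \<longleftrightarrow> y = 0" using nd3[of x] nd3[of y] * by auto
      show "x = y"
      proof (cases "x = 0")
        case False
        hence y: "y \<noteq> 0" using zero by simp
        have lgx: "lg (x * snd (b (i, x)) mod p) = (lg x + snd (balanced_shift h (i, lg x))) mod (2 * h)"
          if "x < p" "x \<noteq> 0" for x
          using lg_mult[OF nd[OF that] nd2[OF that(2), of i]] lgb[OF that i] h by simp
        have eq: "(lg x + snd (balanced_shift h (i, lg x))) mod (2 * h)
            = (lg y + snd (balanced_shift h (i, lg y))) mod (2 * h)"
          using lgx[of x] lgx[of y] * False y by simp
        have "lg x \<in> {..<2 * h}" "lg y \<in> {..<2 * h}"
          using lg_lt False y *(1,2) by auto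
        hence "lg x = lg y"
          by (rule inj_onD[OF inj_on_add_balanced_shift[OF i, of h] eq])
        thus ?thesis using lg_inj False y *(1,2) by auto
      qed (use zero in auto)
    qed
  qed
  thus ?thesis by blast
qed

end

lemma ex_balanced_multipliers_prod:
  assumes "finite Q" "\<And>q. q \<in> Q \<Longrightarrow> prime q \<and> odd (q::nat)"
  shows "\<exists>b. balanced_multipliers (2 * \<Prod>Q) b"
  using assms
proof (induction Q)
  case empty
  show ?case using balanced_multipliers_le_2[of 2] by auto
next
  case (insert q Q)
  have q: "prime q" "odd q" using insert.prems by auto
  have "coprime q r" if "r \<in> Q" for r
    using insert q that by (intro primes_coprime) auto
  hence "coprime q (2 * \<Prod>Q)"
    using q by (auto intro: prod_coprime_right)
  moreover obtain b where "balanced_multipliers (2 * \<Prod>Q) b" using insert by auto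
  moreover obtain b' where "balanced_multipliers q b'"
    using ex_primroot_mod_prime[OF q(1)] primroot_mod_prime.ex_balanced_multipliers q(2) by blast
  ultimately show ?case
    using balanced_multipliers_coprime_mult[of q "2 * \<Prod>Q"] insert.hyps
    by (metis mult.left_commute prod.insert)
qed

subsection \<open>Existence\<close>

lemma ex_exponential_orthomorphismI:
  assumes "\<sigma> ` {1..n - 1} \<subseteq> {1..n - 1}" "inj_on \<sigma> {1..n - 1}"
    "(\<lambda>x. x ^ \<sigma> x mod n) ` {1..n - 1} \<subseteq> {1..n - 1}" "inj_on (\<lambda>x. x ^ \<sigma> x mod n) {1..n - 1}"
  shows "\<exists>\<sigma>. exponential_orthomorphism n \<sigma>"
proof
  \<comment> \<open>\<open>permutes\<close> demands that all other points be fixed.\<close>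
  let ?s = "\<lambda>x. if x \<in> {1..n - 1} then \<sigma> x else x"
  have "bij_betw \<sigma> {1..n - 1} {1..n - 1}"
    using assms endo_inj_surj[OF _ assms(1,2)] by (simp add: bij_betw_def)
  hence "bij_betw ?s {1..n - 1} {1..n - 1}"
    by (rule bij_betw_cong[THEN iffD1, rotated]) auto
  hence "?s permutes {1..n - 1}"
    by (rule bij_imp_permutes) auto
  moreover have "bij_betw (\<lambda>x. x ^ \<sigma> x mod n) {1..n - 1} {1..n - 1}"
    using endo_inj_surj[OF _ assms(3,4)] assms by (simp add: bij_betw_def)
  hence "bij_betw (\<lambda>x. x ^ ?s x mod n) {1..n - 1} {1..n - 1}"
    by (rule bij_betw_cong[THEN iffD1, rotated]) auto
  ultimately show "exponential_orthomorphism n ?s"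
    by (simp add: exponential_orthomorphism_def)
qed

context primroot_mod_prime
begin

text \<open>A point other than \<open>p\<close> is determined by its parity and its logarithm.
  Positive powers preserve parity, so each parity class can use its own family of multipliers, and
  only the exponent modulo \<open>p - 1\<close> affects the logarithm of the power.\<close>

lemma ex_exponential_orthomorphism_twice_prime:
  assumes odd: "odd p" and b: "balanced_multipliers (p - 1) b"
  shows "\<exists>\<sigma>. exponential_orthomorphism (2 * p) \<sigma>"
proof -
  define N where "N = p - 1"
  have pN: "p = N + 1" using prime_gt_0_nat[OF p] by (simp add: N_def)
  have N: "0 < N" using prime_gt_1_nat[OF p] by (simp add: N_def)
  define e where "e = (\<lambda>(k, w). k * N + w + (if w = 0 then N else 0))"
  have e: "e (k, w) = k * N + w + (if w = 0 then N else 0)" for k w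
    by (simp add: e_def)
  have e_mod: "e u mod N = snd u mod N" for u
    by (cases u) (simp add: e)
  have e_range: "e u \<in> {1..2 * N}" if "u \<in> {..<2} \<times> {..<N}" for u
    using that N by (cases u) (auto simp: e less_2_cases_iff)
  have e_inj: "u = w" if "e u = e w" and u: "u \<in> {..<2} \<times> {..<N}" and w: "w \<in> {..<2} \<times> {..<N}" for u w
  proof -
    have "snd u = snd w"
      using e_mod[of u] e_mod[of w] that by auto
    thus ?thesis using that N by (cases u; cases w) (auto simp: e)
  qed
  define \<sigma> where "\<sigma> x = (if x = p then 2 * N + 1 else e (b (x mod 2, lg x)))" for x
  have \<sigma>: "\<sigma> x = e (b (x mod 2, lg x))" if "x \<noteq> p" for x
    using that by (simp add: \<sigma>_def)
  have \<sigma>p: "\<sigma> p = 2 * N + 1" by (simp add: \<sigma>_def)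
  let ?S = "{1..2 * p - 1}"
  have nd: "\<not> p dvd x" if "x \<in> ?S" "x \<noteq> p" for x
  proof
    assume "p dvd x"
    then obtain k where k: "x = p * k" ..
    have "p * k < p * 2" using that(1) pN unfolding k by simp
    hence "k = 0 \<or> k = 1" by auto
    thus False using that unfolding k by auto
  qed
  have lg_lt: "lg x < N" if "x \<in> ?S" "x \<noteq> p" for x
    using lg_less[OF nd[OF that]] by (simp add: N_def)
  have eqI: "x = y" if "x mod 2 = y mod 2" "x mod p = y mod p" "x \<in> ?S" "y \<in> ?S" for x y
    using coprime_cong_mult_nat[of x y 2 p] odd that
    by (intro cong_less_modulus_unique_nat[of x y "2 * p"]) (auto simp: cong_def)
  have lg_eqI: "x = y" if "x mod 2 = y mod 2" "lg x = lg y" "x \<in> ?S" "x \<noteq> p" "y \<in> ?S" "y \<noteq> p" for x y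
    by (rule eqI) (use that lg_eq_iff[OF nd[OF that(3,4)] nd[OF that(5,6)]] in \<open>simp_all add: cong_def\<close>)
  have b_range: "b (x mod 2, lg x) \<in> {..<2} \<times> {..<N}" if "x \<in> ?S" "x \<noteq> p" for x
    using b lg_lt[OF that] unfolding balanced_multipliers_def N_def
    by (intro bij_betw_apply[of b]) auto
  have \<sigma>_range: "\<sigma> x \<in> {1..2 * N}" if "x \<in> ?S" "x \<noteq> p" for x
    using e_range[OF b_range[OF that]] that by (simp add: \<sigma>)
  have \<sigma>_pos: "\<sigma> x > 0" if "x \<in> ?S" for x
    using \<sigma>_range[OF that] by (cases "x = p") (auto simp: \<sigma>p)
  let ?f = "\<lambda>x. x ^ \<sigma> x mod (2 * p)"
  have f_mod2: "?f x mod 2 = x mod 2" if "x \<in> ?S" for x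
  proof -
    have "even (?f x) \<longleftrightarrow> even x"
      using \<sigma>_pos[OF that] dvd_mod_iff[of 2 "2 * p" "x ^ \<sigma> x"] by simp
    thus ?thesis by (simp only: mod2_eq_if)
  qed
  have dvd_f: "p dvd ?f x \<longleftrightarrow> p dvd x" if "x \<in> ?S" for x
    using dvd_mod_iff[of p "2 * p" "x ^ \<sigma> x"] prime_dvd_power_iff[OF p \<sigma>_pos[OF that]] by simp
  have f_range: "?f x \<in> ?S" if "x \<in> ?S" for x
  proof -
    have "?f x \<noteq> 0"
    proof
      assume "?f x = 0"
      hence "even x" "p dvd x"
        using f_mod2[OF that] dvd_f[OF that] by (auto simp: even_iff_mod_2_eq_zero)
      thus False using nd[OF that] odd by auto
    qed
    thus ?thesis using prime_gt_0_nat[OF p] by (simp add: less_Suc_eq_le[symmetric])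
  qed
  show ?thesis
  proof (rule ex_exponential_orthomorphismI)
    show "\<sigma> ` ?S \<subseteq> ?S"
    proof (rule image_subsetI)
      fix x assume "x \<in> ?S"
      hence "\<sigma> x \<in> {1..2 * N + 1}"
        using \<sigma>_range[of x] by (cases "x = p") (auto simp: \<sigma>p)
      thus "\<sigma> x \<in> ?S" by (simp add: pN)
    qed
    show "inj_on \<sigma> ?S"
    proof (rule inj_onI)
      fix x y assume *: "x \<in> ?S" "y \<in> ?S" "\<sigma> x = \<sigma> y"
      have "x = p \<longleftrightarrow> y = p"
        using \<sigma>_range[OF *(1)] \<sigma>_range[OF *(2)] *(3) \<sigma>p by (cases "x = p"; cases "y = p") auto
      moreover have "x = y" if "x \<noteq> p" "y \<noteq> p"
      proof -
        have eq: "b (x mod 2, lg x) = b (y mod 2, lg y)"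
          using *(3) that by (intro e_inj[OF _ b_range[OF *(1)] b_range[OF *(2)]]) (simp_all add: \<sigma>)
        have inj: "inj_on b ({..<2} \<times> {..<N})"
          using b by (simp add: balanced_multipliers_def bij_betw_def N_def)
        have "(x mod 2, lg x) = (y mod 2, lg y)"
          by (rule inj_onD[OF inj eq]) (use lg_lt[OF *(1)] lg_lt[OF *(2)] that in auto)
        thus ?thesis using *(1,2) that by - (rule lg_eqI, auto)
      qed
      ultimately show "x = y" by blast
    qed
    show "?f ` ?S \<subseteq> ?S" using f_range by blast
    show "inj_on ?f ?S"
    proof (rule inj_onI)
      fix x y assume *: "x \<in> ?S" "y \<in> ?S" "?f x = ?f y"
      have par: "x mod 2 = y mod 2" using f_mod2 * by metis
      have "p dvd x \<longleftrightarrow> p dvd y" using dvd_f * by metis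
      hence "x = p \<longleftrightarrow> y = p" using nd * by auto
      moreover have "x = y" if "x \<noteq> p" "y \<noteq> p"
      proof -
        have lgf: "lg (?f x) = lg x * snd (b (x mod 2, lg x)) mod N" if "x \<in> ?S" "x \<noteq> p" for x
        proof -
          have "lg (?f x) = lg x * e (b (x mod 2, lg x)) mod N"
            using lg_power[OF nd[OF that]] that by (simp add: lg_mod_mult \<sigma> N_def)
          thus ?thesis using e_mod by (metis mod_mult_right_eq)
        qed
        have eq: "lg x * snd (b (x mod 2, lg x)) mod N = lg y * snd (b (x mod 2, lg y)) mod N"
          using lgf[OF *(1) that(1)] lgf[OF *(2) that(2)] *(3) par by simp
        have inj: "inj_on (\<lambda>a. a * snd (b (x mod 2, a)) mod N) {..<N}"
          using b by (simp add: balanced_multipliers_def N_def)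
        have "lg x = lg y"
          by (rule inj_onD[OF inj eq]) (use lg_lt[OF *(1)] lg_lt[OF *(2)] that in auto)
        thus ?thesis using *(1,2) that par by - (rule lg_eqI, auto)
      qed
      ultimately show "x = y" by blast
    qed
  qed
qed

end

text \<open>Each witness makes the power map the identity.\<close>

lemma small_exponential_orthomorphism:
  assumes "n = 2 \<or> n = 3 \<or> n = 4"
  shows "\<exists>\<sigma>. exponential_orthomorphism n \<sigma>"
proof -
  have S: "{1..3 - 1} = {1, 2::nat}" "{1..4 - 1} = {1, 2, 3::nat}" by auto
  have "\<exists>\<sigma>. exponential_orthomorphism 2 \<sigma>"
    by (rule ex_exponential_orthomorphismI[where \<sigma> = id]) auto
  moreover have "\<exists>\<sigma>. exponential_orthomorphism 3 \<sigma>"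
    by (rule ex_exponential_orthomorphismI[where \<sigma> = "\<lambda>x. 3 - x"]; simp only: S; simp)
  moreover have "\<exists>\<sigma>. exponential_orthomorphism 4 \<sigma>"
    by (rule ex_exponential_orthomorphismI[where \<sigma> = "\<lambda>x. if x = 1 then 2 else if x = 2 then 1 else x"];
        simp only: S; simp)
  ultimately show ?thesis using assms by blast
qed

subsection \<open>Square factors and two odd prime factors\<close>

lemma exponential_orthomorphism_exponent:
  assumes "exponential_orthomorphism n \<sigma>"
  shows "x \<in> {1..n - 1} \<Longrightarrow> \<sigma> x \<in> {1..n - 1}"
    and "inj \<sigma>"
    and "bij_betw \<sigma> {1..n - 1} {1..n - 1}"
  using assms permutes_in_image[of \<sigma> "{1..n - 1}" x] permutes_inj[of \<sigma> "{1..n - 1}"]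
    permutes_imp_bij[of \<sigma> "{1..n - 1}"]
  unfolding exponential_orthomorphism_def by blast+

lemma exponential_orthomorphism_square_factor:
  assumes eo: "exponential_orthomorphism n \<sigma>" and r: "prime r" "r\<^sup>2 dvd n" and n: "n > 4"
  shows False
proof -
  \<comment> \<open>Since \<open>r\<^sup>2\<close> divides \<open>n\<close>, reduction modulo
    \<open>n\<close> preserves divisibility by \<open>r\<close> and by \<open>r\<^sup>2\<close>. A
    preimage of \<open>y\<close> is thus divisible by \<open>r\<close>, and an exponent of 2 or more
    would put \<open>r\<^sup>2\<close> into \<open>y\<close>.\<close>
  have exp1: "\<sigma> y = 1" if y: "y \<in> {1..n - 1}" "r dvd y" "\<not> r\<^sup>2 dvd y" for y
  proof -
    have "(\<lambda>x. x ^ \<sigma> x mod n) ` {1..n - 1} = {1..n - 1}"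
      using eo by (simp add: exponential_orthomorphism_def bij_betw_def)
    then obtain x where x: "x \<in> {1..n - 1}" and yx: "y = x ^ \<sigma> x mod n"
      using y(1) by blast
    have "r dvd n" using r(2) by (metis dvd_mult_left power2_eq_square)
    hence "r dvd x ^ \<sigma> x" using y(2) yx dvd_mod_iff by blast
    hence "r dvd x" using r(1) prime_dvd_power by blast
    have "\<not> r\<^sup>2 dvd x ^ \<sigma> x" using y(3) yx dvd_mod_iff[OF r(2)] by blast
    moreover have "r\<^sup>2 dvd x ^ \<sigma> x" if "2 \<le> \<sigma> x"
      using \<open>r dvd x\<close> that by (meson dvd_power_le)
    ultimately have "\<sigma> x = 1"
      using exponential_orthomorphism_exponent(1)[OF eo x] by (cases "2 \<le> \<sigma> x") auto
    moreover have "x < n" using x by auto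
    ultimately show ?thesis using yx by simp
  qed
  obtain m where m: "n = r\<^sup>2 * m" using r(2) ..
  have r2: "2 \<le> r" using r(1) prime_ge_2_nat by blast
  have "0 < m" using m n by (cases m) auto
  have nr: "n = r * (r * m)" using m by (simp add: power2_eq_square)
  \<comment> \<open>The only exception would be \<open>r = 2\<close>, \<open>m = 1\<close>, that is
    \<open>n = 4\<close>. The bound makes \<open>r\<close> and \<open>n - r\<close>
    distinct.\<close>
  have rm: "2 < r * m"
  proof (rule ccontr)
    assume "\<not> 2 < r * m"
    moreover have "r \<le> r * m" using \<open>0 < m\<close> by simp
    ultimately have "r = 2" "r * m = 2" using r2 by linarith+
    thus False using nr n by simp
  qed
  have "r * 2 < r * (r * m)" using rm r2 by (intro mult_strict_left_mono) auto
  hence less: "2 * r < n" using nr by simp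
  have nd: "\<not> r\<^sup>2 dvd r" 
    using r2 by (auto simp: power2_eq_square dest: dvd_imp_le)
  have "\<sigma> r = 1" using less r2 nd by (intro exp1) auto
  moreover have "\<sigma> (n - r) = 1"
  proof (rule exp1)
    show "n - r \<in> {1..n - 1}" using less r2 by auto
    show "r dvd n - r" using nr by (metis dvd_diff_nat dvd_refl dvd_triv_left)
    show "\<not> r\<^sup>2 dvd n - r"
      using nd r(2) less dvd_diffD1[of "r\<^sup>2" n r] by auto
  qed
  ultimately have "r = n - r"
    using injD[OF exponential_orthomorphism_exponent(2)[OF eo]] by metis
  thus False using less by simp
qed

lemma square_mod_in_image:
  fixes z p :: nat
  shows "z\<^sup>2 mod (2 * a + 1) \<in> (\<lambda>w. w\<^sup>2 mod (2 * a + 1)) ` {..a}"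
proof -
  let ?p = "2 * a + 1"
  define w where "w = z mod ?p"
  have w: "w < ?p" by (simp add: w_def)
  have zw: "z\<^sup>2 mod ?p = w\<^sup>2 mod ?p" by (simp add: w_def power_mod)
  have "(?p - w)\<^sup>2 mod ?p = w\<^sup>2 mod ?p"
  proof -
    have "[int (?p - w) = - int w] (mod int ?p)"
      using w by (simp add: of_nat_diff cong_iff_dvd_diff)
    from cong_pow[OF this, of 2] have "[(?p - w)\<^sup>2 = w\<^sup>2] (mod ?p)"
      by (simp flip: cong_int_iff)
    thus ?thesis by (simp add: cong_def)
  qed
  moreover have "w \<le> a \<or> ?p - w \<le> a" using w by auto
  ultimately have "\<exists>v\<in>{..a}. w\<^sup>2 mod ?p = v\<^sup>2 mod ?p"
    by (metis atMost_iff)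
  thus ?thesis unfolding zw image_iff .
qed

text \<open>At least \<open>n / 2\<close> residues are squares modulo both primes, while with
  \<open>p = 2 * a + 1\<close> and \<open>q = 2 * b + 1\<close> at most
  \<open>m * (a + 1) * (b + 1)\<close> can be. Expanding \<open>p * q\<close>, the linear terms
  cancel and \<open>2 * a * b\<close> is at most 1.\<close>

lemma exponential_orthomorphism_two_odd_primes:
  assumes eo: "exponential_orthomorphism n \<sigma>" and n: "0 < n"
    and p: "prime p" "odd p" "p dvd n" and q: "prime q" "odd q" "q dvd n" and pq: "p \<noteq> q"
  shows False
proof -
  obtain a where a: "p = 2 * a + 1" using p(2) by (elim oddE)
  obtain b where b: "q = 2 * b + 1" using q(2) by (elim oddE)
  have ab: "0 < a" "0 < b" using prime_gt_1_nat[OF p(1)] prime_gt_1_nat[OF q(1)] a b by auto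
  have co: "coprime p q" using p q pq by (intro primes_coprime) auto
  then obtain m where m: "n = p * q * m" using divides_mult[OF p(3) q(3)] by blast
  define f where "f x = x ^ \<sigma> x mod n" for x
  define X where "X = {x \<in> {1..n - 1}. even (\<sigma> x)}"
  \<comment> \<open>Adding 0, a square that \<open>f\<close> never takes, lifts the count from
    \<open>(n - 1) div 2\<close> to at least \<open>n / 2\<close>.\<close>
  define E where "E = insert 0 (f ` X)"
  have bij_f: "bij_betw f {1..n - 1} {1..n - 1}"
    using eo by (simp add: exponential_orthomorphism_def f_def[abs_def])
  have "card X = card {e \<in> {1..n - 1}. even e}"
    unfolding X_def
    by (rule bij_betw_same_card[OF bij_betw_Collect[OF exponential_orthomorphism_exponent(3)[OF eo]]]) simp
  also have "\<dots> = card {1..(n - 1) div 2}"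
    by (rule bij_betw_same_card[OF bij_betwI[where f = "\<lambda>e. e div 2" and g = "\<lambda>k. 2 * k"]]) auto
  finally have "card X = (n - 1) div 2" by simp
  moreover have "inj_on f X"
    using bij_f unfolding bij_betw_def X_def by (auto intro: inj_on_subset)
  moreover have "f ` X \<subseteq> {1..n - 1}"
    using bij_betw_imp_surj_on[OF bij_f] unfolding X_def by blast
  hence "0 \<notin> f ` X" by auto
  ultimately have "card E = (n - 1) div 2 + 1"
    unfolding E_def by (subst card_insert_disjoint) (auto simp: X_def card_image)
  hence "n \<le> 2 * card E" using n by auto
  let ?Q = "\<lambda>a. (\<lambda>w. w\<^sup>2 mod (2 * a + 1)) ` {..a}"
  have sq: "y mod (2 * a + 1) \<in> ?Q a" if y: "y \<in> E" and "2 * a + 1 dvd n" for y a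
  proof -
    have "\<exists>z. y mod (2 * a + 1) = z\<^sup>2 mod (2 * a + 1)"
    proof (cases "y = 0")
      case True
      thus ?thesis by (intro exI[of _ 0]) simp
    next
      case False
      then obtain x where x: "x \<in> X" "y = f x" using y unfolding E_def by blast
      then obtain k where "\<sigma> x = 2 * k" unfolding X_def by auto
      hence "y mod (2 * a + 1) = (x ^ k)\<^sup>2 mod (2 * a + 1)"
        using x(2) that(2) by (simp add: f_def mod_mod_cancel mult.commute flip: power_mult)
      thus ?thesis ..
    qed
    thus ?thesis using square_mod_in_image[of _ a] by metis
  qed
  \<comment> \<open>The residues modulo \<open>p\<close> and \<open>q\<close> fix \<open>y\<close>
    modulo \<open>p * q\<close>; the quotient supplies the rest.\<close>
  let ?h = "\<lambda>y. (y div (p * q), y mod p, y mod q)"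
  have "inj_on ?h E"
  proof (rule inj_onI)
    fix x y assume "?h x = ?h y"
    hence *: "x div (p * q) = y div (p * q)" "[x = y] (mod p)" "[x = y] (mod q)"
      by (auto simp: cong_def)
    from coprime_cong_mult_nat[OF *(2,3) co] have "x mod (p * q) = y mod (p * q)"
      by (simp add: cong_def)
    thus "x = y" using *(1) by (metis div_mult_mod_eq)
  qed
  moreover have "?h ` E \<subseteq> {..<m} \<times> ?Q a \<times> ?Q b"
  proof (rule image_subsetI)
    fix y assume y: "y \<in> E"
    hence "y < m * (p * q)" using n unfolding E_def f_def m by (auto simp: ac_simps)
    hence "y div (p * q) < m" by (rule less_mult_imp_div_less)
    thus "?h y \<in> {..<m} \<times> ?Q a \<times> ?Q b"
      using sq[OF y, of a] sq[OF y, of b] p(3) q(3) unfolding a b by simp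
  qed
  ultimately have "card E \<le> card ({..<m} \<times> ?Q a \<times> ?Q b)"
    by (intro card_inj_on_le) auto
  also have "\<dots> \<le> m * ((a + 1) * (b + 1))"
    unfolding card_cartesian_product
    by (intro mult_mono) (use card_image_le[of "{..a}"] card_image_le[of "{..b}"] in auto)
  finally have "p * q * m \<le> 2 * (m * ((a + 1) * (b + 1)))"
    using \<open>n \<le> 2 * card E\<close> m by simp
  hence "m * (p * q) \<le> m * (2 * ((a + 1) * (b + 1)))"
    by (simp add: ac_simps)
  moreover have "0 < m" using n m by simp
  ultimately have "p * q \<le> 2 * ((a + 1) * (b + 1))"
    by (rule mult_le_cancel1[THEN iffD1, rule_format])
  hence "2 * (a * b) \<le> 1" unfolding a b by (simp add: algebra_simps)
  thus False using ab by (cases a; cases b) auto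
qed

subsection \<open>Necessary conditions modulo a prime and twice a prime\<close>

context primroot_mod_prime
begin

context
  fixes c :: nat and \<sigma> :: "nat \<Rightarrow> nat"
  assumes eo: "exponential_orthomorphism (c * p) \<sigma>" and c: "0 < c"
begin

text \<open>Only divisibility by \<open>p\<close> is excluded: for \<open>c = 2\<close> even points
  belong to the set as well.\<close>

definition units :: "nat set" where
  "units = {x \<in> {1..c * p - 1}. \<not> p dvd x}"

lemma finite_units: "finite units"
  by (simp add: units_def)

lemma bij_betw_power_units: "bij_betw (\<lambda>x. x ^ \<sigma> x mod (c * p)) units units"
  unfolding units_def
proof (rule bij_betw_Collect)
  show "bij_betw (\<lambda>x. x ^ \<sigma> x mod (c * p)) {1..c * p - 1} {1..c * p - 1}"
    using eo by (simp add: exponential_orthomorphism_def)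
  fix x assume "x \<in> {1..c * p - 1}"
  hence "0 < \<sigma> x" using exponential_orthomorphism_exponent(1)[OF eo] by fastforce
  thus "(\<not> p dvd x ^ \<sigma> x mod (c * p)) = (\<not> p dvd x)"
    using p dvd_mod_iff[of p "c * p" "x ^ \<sigma> x"] by (simp add: prime_dvd_power_iff)
qed

lemma lg_power_units:
  assumes "x \<in> units" shows "lg (x ^ \<sigma> x mod (c * p)) = lg x * \<sigma> x mod (p - 1)"
  using assms by (simp add: lg_mod_mult lg_power units_def)

text \<open>Division by \<open>p - 1\<close> splits \<open>e\<close> into a logarithm and the
  quotient of the point by \<open>p\<close>. Counting points by logarithm thereby becomes counting
  integers in \<open>{..<c * (p - 1)}\<close>.\<close>

definition lift :: "nat \<Rightarrow> nat" where
  "lift e = g ^ (e mod (p - 1)) mod p + e div (p - 1) * p"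

lemma lift_mod: "lift e mod p = g ^ (e mod (p - 1)) mod p"
  by (simp add: lift_def)

lemma lift_div: "lift e div p = e div (p - 1)"
  using prime_gt_0_nat[OF p] by (simp add: lift_def)

lemma lg_lift: "lg (lift e) = e mod (p - 1)"
  using lg_unique[of "e mod (p - 1)" "lift e"] lift_mod[of e] by (simp add: cong_def)

lemma bij_betw_lift: "bij_betw lift {..<c * (p - 1)} units"
  unfolding bij_betw_def
proof
  have N: "0 < p - 1" using prime_gt_1_nat[OF p] by simp
  show "inj_on lift {..<c * (p - 1)}"
    by (rule inj_onI) (metis lg_lift lift_div div_mult_mod_eq)
  have "lift e \<in> units" if "e < c * (p - 1)" for e
  proof -
    have "\<not> p dvd lift e"
      using lift_mod[of e] not_dvd_g_power by (simp add: dvd_eq_mod_eq_0)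
    moreover have "lift e div p < c"
      unfolding lift_div using that by (rule less_mult_imp_div_less)
    hence "lift e < c * p" using prime_gt_0_nat[OF p] by (simp add: div_less_iff_less_mult)
    ultimately show ?thesis by (cases "lift e = 0") (auto simp: units_def)
  qed
  moreover have "\<exists>e<c * (p - 1). lift e = x" if "x \<in> units" for x
  proof -
    have x: "x < c * p" "\<not> p dvd x" using that by (auto simp: units_def)
    let ?e = "x div p * (p - 1) + lg x"
    have e: "?e div (p - 1) = x div p" "?e mod (p - 1) = lg x"
      using lg_less[OF x(2)] by simp_all
    have "x div p < c" using x(1) by (rule less_mult_imp_div_less)
    hence "?e < c * (p - 1)" using e(1) N by (metis div_less_iff_less_mult)
    moreover have "lift ?e = x mod p + x div p * p"
      unfolding lift_def e using g_power_lg[OF x(2)] by (simp add: cong_def)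
    ultimately show ?thesis by (metis add.commute div_mult_mod_eq)
  qed
  ultimately show "lift ` {..<c * (p - 1)} = units" by blast
qed

context
  fixes q :: nat
  assumes q: "prime q" "q dvd p - 1"
begin

lemma dvd_lg_power_units:
  assumes "x \<in> units"
  shows "q dvd lg (x ^ \<sigma> x mod (c * p)) \<longleftrightarrow> q dvd lg x \<or> q dvd \<sigma> x"
  using q unfolding lg_power_units[OF assms] by (simp add: dvd_mod_iff prime_dvd_mult_iff)

text \<open>The power map permutes the units, so equally many points have logarithm prime to
  \<open>q\<close> before and after it. The latter points lie among the former, so the two sets
  agree and no exponent on them is divisible by \<open>q\<close>.\<close>

lemma log_exponent_dvd:
  assumes "x \<in> units" "q dvd \<sigma> x" shows "q dvd lg x"
proof (rule ccontr)
  assume x: "\<not> q dvd lg x"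
  let ?f = "\<lambda>x. x ^ \<sigma> x mod (c * p)"
  let ?A = "{x \<in> units. \<not> q dvd lg x}" and ?C = "{x \<in> units. \<not> q dvd lg (?f x)}"
  have "card ?C = card ?A"
    by (intro bij_betw_same_card[of ?f] bij_betw_Collect[OF bij_betw_power_units]) simp
  moreover have "?C \<subseteq> ?A" using dvd_lg_power_units by blast
  ultimately have "?C = ?A" using finite_units by (intro card_subset_eq) auto
  thus False using x assms dvd_lg_power_units by blast
qed

text \<open>Exponents prime to \<open>q\<close> lie below \<open>c * (p - 1)\<close>, where they are
  as many as the points with logarithm prime to \<open>q\<close>, or among the \<open>c - 1\<close>
  integers strictly between \<open>c * (p - 1)\<close> and \<open>c * p\<close>. Those points
  already use up as many exponents prime to \<open>q\<close>.\<close>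

lemma card_bad_exponents:
  "card {x \<in> units. q dvd lg x \<and> \<not> q dvd \<sigma> x} < c"
proof -
  let ?A = "{x \<in> units. \<not> q dvd lg x}" and ?B = "{x \<in> units. \<not> q dvd \<sigma> x}"
  let ?T = "{e \<in> {..<c * (p - 1)}. \<not> q dvd e}"
  have cp: "c * p = c * (p - 1) + c"
    using prime_gt_0_nat[OF p] by (cases p) auto
  have "bij_betw lift ?T ?A"
    using q(2) by (intro bij_betw_Collect[OF bij_betw_lift]) (simp add: lg_lift dvd_mod_iff)
  hence A: "card ?T = card ?A" by (rule bij_betw_same_card)
  have "\<sigma> ` ?B \<subseteq> ?T \<union> {c * (p - 1)<..<c * (p - 1) + c}"
  proof (rule image_subsetI)
    fix x assume x: "x \<in> ?B"
    have "\<sigma> x \<noteq> c * (p - 1)" using x q(2) by (metis (mono_tags) dvd_mult mem_Collect_eq)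
    moreover have "\<sigma> x \<in> {1..c * p - 1}"
      using x exponential_orthomorphism_exponent(1)[OF eo] by (simp add: units_def)
    ultimately show "\<sigma> x \<in> ?T \<union> {c * (p - 1)<..<c * (p - 1) + c}"
      using x c cp by auto
  qed
  hence "card ?B \<le> card (?T \<union> {c * (p - 1)<..<c * (p - 1) + c})"
    using exponential_orthomorphism_exponent(2)[OF eo]
    by (intro card_inj_on_le[of \<sigma>]) (auto intro: inj_on_subset)
  also have "\<dots> \<le> card ?T + card {c * (p - 1)<..<c * (p - 1) + c}" by (rule card_Un_le)
  also have "\<dots> = card ?A + (c - 1)" by (simp only: A) simp
  finally have "card ?B \<le> card ?A + (c - 1)" .
  moreover have "?A \<subseteq> ?B" using log_exponent_dvd by blast
  hence "card (?B - ?A) = card ?B - card ?A"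
    using finite_units by (intro card_Diff_subset) auto
  moreover have "?B - ?A = {x \<in> units. q dvd lg x \<and> \<not> q dvd \<sigma> x}" by blast
  ultimately show ?thesis using c by simp
qed

text \<open>There are \<open>c\<close> points with logarithm exactly \<open>q\<close>, one for each
  quotient by \<open>p\<close>. Each needs a preimage counted in \<open>card_bad_exponents\<close>,
  which allows fewer than \<open>c\<close>.\<close>

lemma not_square_dvd: "\<not> q\<^sup>2 dvd p - 1"
proof
  assume q2: "q\<^sup>2 dvd p - 1"
  let ?f = "\<lambda>x. x ^ \<sigma> x mod (c * p)"
  let ?Y = "{y \<in> units. q dvd lg y \<and> \<not> q\<^sup>2 dvd lg y}"
  have N: "0 < p - 1" using prime_gt_1_nat[OF p] by simp
  have q_gt: "1 < q" using q(1) prime_gt_1_nat by blast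
  have "q < q\<^sup>2" using q_gt by (simp add: power2_eq_square)
  hence "q < p - 1" using dvd_imp_le[OF q2 N] by simp
  have "(\<lambda>j. lift (j * (p - 1) + q)) ` {..<c} \<subseteq> ?Y"
  proof (rule image_subsetI)
    fix j assume j: "j \<in> {..<c}"
    have "(j * (p - 1) + q) div (p - 1) < c" using j \<open>q < p - 1\<close> by simp
    hence "j * (p - 1) + q < c * (p - 1)" using N by (metis div_less_iff_less_mult)
    hence "lift (j * (p - 1) + q) \<in> units"
      using bij_betw_apply[OF bij_betw_lift] by simp
    moreover have "lg (lift (j * (p - 1) + q)) = q"
      using \<open>q < p - 1\<close> by (simp add: lg_lift)
    moreover have "\<not> q\<^sup>2 dvd q" using \<open>q < q\<^sup>2\<close> q_gt by (auto dest: dvd_imp_le)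
    ultimately show "lift (j * (p - 1) + q) \<in> ?Y" by simp
  qed
  moreover have "inj_on (\<lambda>j. lift (j * (p - 1) + q)) {..<c}"
  proof (rule inj_onI)
    fix i j assume "lift (i * (p - 1) + q) = lift (j * (p - 1) + q)"
    from arg_cong[OF this, of "\<lambda>x. x div p"] show "i = j"
      using \<open>q < p - 1\<close> by (simp add: lift_div)
  qed
  ultimately have le: "c \<le> card ?Y"
    using card_inj_on_le[of "\<lambda>j. lift (j * (p - 1) + q)" "{..<c}" ?Y] finite_units by simp
  
  have "?Y \<subseteq> ?f ` {x \<in> units. q dvd lg x \<and> \<not> q dvd \<sigma> x}"
  proof
    fix y assume y: "y \<in> ?Y"
    hence "y \<in> ?f ` units" using bij_betw_imp_surj_on[OF bij_betw_power_units] by simp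
    then obtain x where x: "x \<in> units" "y = ?f x" by blast
    have dvd: "q dvd lg x"
      using y x dvd_lg_power_units[OF x(1)] log_exponent_dvd[OF x(1)] by blast
    have "\<not> q\<^sup>2 dvd lg x * \<sigma> x"
      using y q2 lg_power_units[OF x(1)] x(2) by (simp add: dvd_mod_iff)
    hence "\<not> q dvd \<sigma> x" using dvd by (auto simp: power2_eq_square dest: mult_dvd_mono)
    thus "y \<in> ?f ` {x \<in> units. q dvd lg x \<and> \<not> q dvd \<sigma> x}" using x dvd by blast
  qed
  hence "card ?Y \<le> card {x \<in> units. q dvd lg x \<and> \<not> q dvd \<sigma> x}"
    using finite_units by (intro surj_card_le) auto
  also have "\<dots> < c" by (rule card_bad_exponents)
  finally show False using le by simp
qed

end

lemma squarefree_pred: "squarefree (p - 1)"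
proof -
  have "\<not> q\<^sup>2 dvd p - 1" if "prime q" for q
    using not_square_dvd[OF that] by (metis dvd_mult_left power2_eq_square)
  thus ?thesis
    using prime_gt_1_nat[OF p] by (subst squarefree_factorial_semiring) auto
qed

end

end

section \<open>Odd prime moduli\<close>

lemma squarefree_dvd_iff:
  fixes m :: nat
  assumes "squarefree m"
  shows "m dvd a \<longleftrightarrow> (\<forall>r. prime r \<longrightarrow> r dvd m \<longrightarrow> r dvd a)"
proof
  assume *: "\<forall>r. prime r \<longrightarrow> r dvd m \<longrightarrow> r dvd a"
  have m: "m \<noteq> 0" using assms by (cases "m = 0") auto
  show "m dvd a"
  proof (cases "a = 0")
    case False
    show ?thesis
    proof (rule multiplicity_le_imp_dvd[OF m])
      fix r :: nat assume r: "prime r"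
      show "multiplicity r m \<le> multiplicity r a"
      proof (cases "r dvd m")
        case True
        have "multiplicity r m \<le> 1"
          using assms r squarefree_factorial_semiring''[OF m] by blast
        also have "1 \<le> multiplicity r a"
          using * True r False by (simp add: prime_multiplicity_gt_zero_iff Suc_le_eq)
        finally show ?thesis .
      qed (simp add: not_dvd_imp_multiplicity_0)
    qed
  qed simp
qed (blast intro: dvd_trans)

text \<open>Fermat removes the factor \<open>m ^ (q - 1)\<close> and Wilson gives -1 for the
  factorial, which differs from 1 modulo odd \<open>q\<close>.\<close>

lemma prod_multiples_coprime:
  fixes q m :: nat
  assumes q: "prime q" "odd q" and m: "coprime q m"
  shows "\<not> [(\<Prod>j\<in>{1..q - 1}. m * j) = 1] (mod q)"
proof
  assume "[(\<Prod>j\<in>{1..q - 1}. m * j) = 1] (mod q)"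
  hence "[m ^ (q - 1) * fact (q - 1) = 1] (mod q)"
    by (simp add: prod.distrib fact_prod)
  moreover have "[m ^ (q - 1) * fact (q - 1) = 1 * fact (q - 1)] (mod q)"
    using m q prime_imp_coprime_nat
    by (intro cong_mult fermat_theorem) (auto simp: coprime_absorb_left)
  ultimately have "[fact (q - 1) = (1::nat)] (mod q)"
    by (metis cong_sym cong_trans mult_1)
  hence "[int (fact (q - 1)) = int 1] (mod int q)" by (simp only: cong_int_iff)
  moreover have "[fact (q - 1) = (- 1::int)] (mod int q)" using wilson_theorem[OF q(1)] by simp
  ultimately have "[1 = (- 1::int)] (mod int q)"
    by (metis cong_sym cong_trans of_nat_1 of_nat_fact)
  hence "int q dvd 2" by (simp add: cong_iff_dvd_diff)
  hence "q dvd 2" by (metis int_dvd_int_iff of_nat_numeral)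
  thus False using q primes_dvd_imp_eq two_is_prime_nat by blast
qed

context primroot_mod_prime
begin

lemma not_dvd_residue: "x \<in> {1..p - 1} \<Longrightarrow> \<not> p dvd x"
  by (intro nat_dvd_not_less) auto

lemma bij_betw_lg: "bij_betw lg {1..p - 1} {..<p - 1}"
proof -
  note nd = not_dvd_residue
  have "inj_on lg {1..p - 1}"
  proof (rule inj_onI)
    fix x y assume *: "x \<in> {1..p - 1}" "y \<in> {1..p - 1}" "lg x = lg y"
    hence "[x = y] (mod p)" using lg_eq_iff[OF nd nd] by blast
    thus "x = y" using * by (auto simp: cong_def)
  qed
  moreover have "lg ` {1..p - 1} \<subseteq> {..<p - 1}" using lg_less nd by auto
  ultimately show ?thesis
    by (metis bij_betw_def card_atLeastAtMost card_image card_lessThan card_subset_eq diff_Suc_1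
        finite_lessThan)
qed

lemma exponential_orthomorphism_prime:
  assumes eo: "exponential_orthomorphism p \<sigma>" and odd: "odd p"
  shows "p = 3"
proof (rule ccontr)
  assume "p \<noteq> 3"
  hence p5: "5 \<le> p"
    using prime_ge_2_nat[OF p] odd by (cases "p = 2"; cases "p = 4") auto
  define N where "N = p - 1"
  have N: "4 \<le> N" "even N" using p5 odd by (auto simp: N_def)
  have eo1: "exponential_orthomorphism (1 * p) \<sigma>" using eo by simp
  have units: "units 1 = {1..N}"
    unfolding units_def[OF eo1 zero_less_one] N_def
    using not_dvd_residue by auto
  have sf: "squarefree N"
    using squarefree_pred[OF eo1] by (simp add: N_def)
  \<comment> \<open>Here \<open>p = 3\<close> escapes: then \<open>N div 2\<close> is 1 and has no
    prime factor. A prime factor of \<open>N div 2\<close> must be odd because \<open>N\<close> is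
    squarefree.\<close>
  have "N div 2 \<noteq> 1" using N by auto
  then obtain q where q: "prime q" "q dvd N div 2" using prime_factor_nat by blast
  have N2: "N = 2 * (N div 2)" using N by simp
  have "odd q"
  proof
    assume "even q"
    hence "2\<^sup>2 dvd N" using q(2) N2 by (metis dvd_trans mult_dvd_mono dvd_refl power2_eq_square)
    thus False using squarefreeD[OF sf, of 2] by simp
  qed
  have qN: "q dvd N" using q(2) N2 by (metis dvd_mult)
  then obtain m where m: "N = q * m" ..
  have sfm: "squarefree m" using sf m squarefree_mono by (metis dvd_triv_right)
  have co: "coprime q m"
  proof (rule prime_imp_coprime[OF q(1)])
    show "\<not> q dvd m"
      using squarefreeD[OF sf, of q] m q(1) by (auto simp: power2_eq_square)
  qed
  let ?f = "\<lambda>x. x ^ \<sigma> x mod p"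
  have lgf: "lg (?f x) = lg x * \<sigma> x mod N" if "x \<in> {1..N}" for x
    using lg_power_units[OF eo1, of x] that units by (simp add: N_def)
  have dvd_iff: "r dvd \<sigma> x \<longleftrightarrow> r dvd lg x" if "x \<in> {1..N}" "prime r" "r dvd N" for r x
  proof
    show "r dvd lg x" if "r dvd \<sigma> x"
      using log_exponent_dvd[OF eo1 _ \<open>prime r\<close>] that units \<open>x \<in> {1..N}\<close> \<open>r dvd N\<close>
      by (simp add: N_def)
    \<comment> \<open>With \<open>c = 1\<close> the bound on bad exponents is 0.\<close>
    have "{x \<in> units 1. r dvd lg x \<and> \<not> r dvd \<sigma> x} = {}"
      using card_bad_exponents[OF eo1 _ \<open>prime r\<close>] \<open>r dvd N\<close> units by (simp add: N_def)
    thus "r dvd \<sigma> x" if "r dvd lg x"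
      using that units \<open>x \<in> {1..N}\<close> by blast
  qed
  have dvd_f: "r dvd lg (?f x) \<longleftrightarrow> r dvd lg x" if "x \<in> {1..N}" "prime r" "r dvd N" for r x
    using lgf[OF that(1)] that dvd_iff[OF that] by (simp add: dvd_mod_iff prime_dvd_mult_iff)
  let ?P = "\<lambda>a. \<not> q dvd a \<and> m dvd a"
  have mN: "r dvd N" if "r dvd m" for r using that m by simp
  \<comment> \<open>As \<open>m\<close> is squarefree, divisibility by \<open>m\<close> can be
    tested prime by prime.\<close>
  have P\<sigma>: "?P (\<sigma> x) \<longleftrightarrow> ?P (lg x)" and Pf: "?P (lg (?f x)) \<longleftrightarrow> ?P (lg x)" if "x \<in> {1..N}" for x
    using dvd_iff[OF that] dvd_f[OF that] q(1) qN mN by (auto simp: squarefree_dvd_iff[OF sfm])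
  let ?D = "{x \<in> {1..N}. ?P (lg x)}" and ?E = "{e \<in> {1..N}. ?P e}"
  have f: "bij_betw ?f ?D ?D"
  proof (rule bij_betw_Collect)
    show "bij_betw ?f {1..N} {1..N}"
      using eo by (simp add: exponential_orthomorphism_def N_def)
  qed (rule Pf)
  have \<sigma>: "bij_betw \<sigma> ?D ?E"
  proof (rule bij_betw_Collect)
    show "bij_betw \<sigma> {1..N} {1..N}"
      using exponential_orthomorphism_exponent(3)[OF eo] by (simp add: N_def)
  qed (rule P\<sigma>)
  have "bij_betw lg ?D {e \<in> {..<N}. ?P e}"
    unfolding N_def by (rule bij_betw_Collect[OF bij_betw_lg refl])
  \<comment> \<open>Logarithms start at 0 and exponents end at \<open>N\<close>; both extremes are
    multiples of \<open>q\<close> and drop out.\<close>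
  also have "{e \<in> {..<N}. ?P e} = ?E"
  proof -
    have "e \<noteq> 0 \<and> e \<noteq> N" if "\<not> q dvd e" for e
      using that qN by (metis dvd_0_right)
    thus ?thesis by (force simp: Suc_le_eq)
  qed
  finally have lg: "bij_betw lg ?D ?E" .
  \<comment> \<open>The product of the logarithms of the powers is computed twice: by permuting
    \<open>?D\<close>, and as logarithms times exponents. Cancelling leaves 1, against
    \<open>prod_multiples_coprime\<close>.\<close>
  have "[\<Prod>?E = (\<Prod>x\<in>?D. lg (?f x))] (mod q)"
    using prod.reindex_bij_betw[OF f, of lg] prod.reindex_bij_betw[OF lg, of "\<lambda>e. e"] by simp
  also have "[(\<Prod>x\<in>?D. lg (?f x)) = (\<Prod>x\<in>?D. lg x * \<sigma> x)] (mod q)"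
    using lgf qN by (intro cong_prod) (auto simp: cong_def mod_mod_cancel)
  also have "(\<Prod>x\<in>?D. lg x * \<sigma> x) = \<Prod>?E * \<Prod>?E"
    using prod.reindex_bij_betw[OF \<sigma>, of "\<lambda>e. e"] prod.reindex_bij_betw[OF lg, of "\<lambda>e. e"]
    by (simp add: prod.distrib)
  finally have cong: "[\<Prod>?E * 1 = \<Prod>?E * \<Prod>?E] (mod q)" by simp
  have "coprime (\<Prod>?E) q"
    using prime_imp_coprime[OF q(1)] by (intro prod_coprime_left) (auto simp: coprime_commute)
  from cong_sym[OF iffD1[OF cong_mult_lcancel_nat[OF this] cong]] have "[\<Prod>?E = 1] (mod q)" .
  moreover have "bij_betw (\<lambda>j. m * j) {1..q - 1} ?E"
  proof (rule bij_betw_imageI)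
    have "0 < m" using m N by (cases m) auto
    thus "inj_on (\<lambda>j. m * j) {1..q - 1}" by (auto simp: inj_on_def)
    show "(\<lambda>j. m * j) ` {1..q - 1} = ?E"
    proof (intro equalityI subsetI)
      fix e assume "e \<in> (\<lambda>j. m * j) ` {1..q - 1}"
      then obtain j where j: "j \<in> {1..q - 1}" "e = m * j" by blast
      have "j < q" using j(1) by auto
      hence "\<not> q dvd j" using j(1) by (auto dest: dvd_imp_le)
      moreover have "m * j \<le> N" unfolding m using \<open>j < q\<close> by simp
      ultimately show "e \<in> ?E"
        using j co \<open>0 < m\<close> by (auto simp: coprime_dvd_mult_right_iff)
    next
      fix e assume e: "e \<in> ?E"
      then obtain j where j: "e = m * j" by blast
      have "j \<le> q" using e j m \<open>0 < m\<close> by simp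
      moreover have "j \<noteq> q" "j \<noteq> 0" using e j by auto
      ultimately show "e \<in> (\<lambda>j. m * j) ` {1..q - 1}" using j by auto
    qed
  qed
  hence "\<Prod>?E = (\<Prod>j\<in>{1..q - 1}. m * j)"
    using prod.reindex_bij_betw[of "\<lambda>j. m * j" _ ?E "\<lambda>e. e"] by simp
  ultimately show False
    using prod_multiples_coprime[OF q(1) \<open>odd q\<close> co] by simp
qed

end

subsection \<open>The characterization\<close>

lemma only_prime_factor_2:
  fixes m :: nat
  assumes "0 < m" "\<not> 2\<^sup>2 dvd m" "\<And>r. prime r \<Longrightarrow> r dvd m \<Longrightarrow> r = 2"
  shows "m = 1 \<or> m = 2"
proof (cases "m = 1")
  case False
  then obtain r where "prime r" "r dvd m" using prime_factor_nat by blast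
  hence "2 dvd m" using assms(3) by blast
  then obtain l where l: "m = 2 * l" ..
  have "l = 1"
  proof (rule ccontr)
    assume "l \<noteq> 1"
    then obtain r where "prime r" "r dvd l" using prime_factor_nat by blast
    hence "2 dvd l" using assms(3)[of r] l by (metis dvd_mult)
    thus False using assms(2) l by (auto simp: power2_eq_square mult_dvd_mono)
  qed
  thus ?thesis using l by simp
qed simp

text \<open>Half of \<open>N\<close> is odd with all multiplicities 1, so enumerating its prime
  factors suffices; \<open>N = 2\<close> gives \<open>k = 0\<close>.\<close>

lemma squarefree_even_factorization:
  fixes N :: nat
  assumes sf: "squarefree N" and even: "even N"
  shows "\<exists>(k::nat) (q::nat \<Rightarrow> nat). inj_on q {1..k} \<and> (\<forall>i\<in>{1..k}. prime (q i) \<and> odd (q i)) \<and> N = 2 * (\<Prod>i=1..k. q i)"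
proof -
  obtain M where M: "N = 2 * M" using even by (elim evenE)
  have sfM: "squarefree M" using sf M squarefree_mono by (metis dvd_triv_right)
  have M0: "M \<noteq> 0" using sfM by (cases "M = 0") auto
  have "odd M"
  proof
    assume "even M"
    hence "2\<^sup>2 dvd N" using M by (auto simp: power2_eq_square mult_dvd_mono)
    thus False using squarefreeD[OF sf, of 2] by simp
  qed
  have prime: "prime r \<and> odd r" if "r \<in> prime_factors M" for r
    using that \<open>odd M\<close> by (auto simp: prime_factors_dvd dest: dvd_trans)
  obtain q where q: "bij_betw q {1..card (prime_factors M)} (prime_factors M)"
    using ex_bij_betw_nat_finite_1[of "prime_factors M"] by auto
  have "M = (\<Prod>r\<in>prime_factors M. r ^ multiplicity r M)"
    using prime_factorization_nat[of M] M0 by simp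
  also have "\<dots> = (\<Prod>r\<in>prime_factors M. r)"
    using sfM squarefree_factorial_semiring'[OF M0] by (intro prod.cong) auto
  also have "\<dots> = (\<Prod>i=1..card (prime_factors M). q i)"
    using prod.reindex_bij_betw[OF q, of "\<lambda>r. r"] by simp
  finally have "N = 2 * (\<Prod>i=1..card (prime_factors M). q i)" using M by simp
  moreover have "inj_on q {1..card (prime_factors M)}" by (rule bij_betw_imp_inj_on[OF q])
  moreover have "\<forall>i\<in>{1..card (prime_factors M)}. prime (q i) \<and> odd (q i)"
    using bij_betw_apply[OF q] prime by blast
  ultimately show ?thesis by blast
qed

theorem theorem1p4:
  fixes n :: nat
  assumes "n \<ge> 2"
  shows "(\<exists>\<sigma>. exponential_orthomorphism n \<sigma>) \<longleftrightarrow>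
    n = 2 \<or> n = 3 \<or> n = 4 \<or>
    (\<exists>p::nat. n = 2 * p \<and> prime p \<and> odd p \<and>
      (\<exists>(k::nat) (q::nat \<Rightarrow> nat).
         inj_on q {1..k} \<and> (\<forall>i\<in>{1..k}. prime (q i) \<and> odd (q i)) \<and>
         p - 1 = 2 * (\<Prod>i=1..k. q i)))" (is "?L \<longleftrightarrow> _ \<or> _ \<or> _ \<or> ?R")
proof
  assume ?L
  then obtain \<sigma> where eo: "exponential_orthomorphism n \<sigma>" ..
  have ?R if n: "n \<noteq> 2" "n \<noteq> 3" "n \<noteq> 4"
  proof -
    have n5: "4 < n" using n assms by simp
    have sq: "\<not> r\<^sup>2 dvd n" if "prime r" for r
      using exponential_orthomorphism_square_factor[OF eo that _ n5] by blast
    obtain p where p: "prime p" "p dvd n" "p \<noteq> 2"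
      using only_prime_factor_2[of n] sq[of 2] n5 by auto
    have odd: "odd p" using p primes_dvd_imp_eq two_is_prime_nat by blast
    obtain m where m: "n = m * p" using p(2) by (metis dvd_def mult.commute)
    have m0: "0 < m" using m n5 by (cases m) auto
    have "\<not> p dvd m" using sq[OF p(1)] m by (auto simp: power2_eq_square)
    have "r = 2" if "prime r" "r dvd m" for r
    proof (rule ccontr)
      assume "r \<noteq> 2"
      hence "odd r" using that primes_dvd_imp_eq two_is_prime_nat by blast
      moreover have "p \<noteq> r" using that \<open>\<not> p dvd m\<close> by blast
      ultimately show False
        using exponential_orthomorphism_two_odd_primes[OF eo _ p(1) odd p(2) that(1)] n5
          dvd_mult2[OF that(2), of p] unfolding m[symmetric] by auto
    qed
    moreover have "\<not> 2\<^sup>2 dvd m" using sq[of 2] m by auto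
    ultimately have m12: "m = 1 \<or> m = 2" using only_prime_factor_2 m0 by blast
    obtain g where "primroot_mod_prime p g" using ex_primroot_mod_prime[OF p(1)] ..
    then interpret primroot_mod_prime p g .
    \<comment> \<open>Otherwise \<open>n\<close> is the odd prime \<open>p\<close>, which forces the
      excluded \<open>n = 3\<close>.\<close>
    have "m = 2"
    proof (rule ccontr)
      assume "m \<noteq> 2"
      hence "n = p" using m m12 by simp
      thus False using exponential_orthomorphism_prime[of \<sigma>] eo odd n by simp
    qed
    moreover have "squarefree (p - 1)"
      using squarefree_pred[of m \<sigma>] eo m m0 by simp
    ultimately show ?R
      using squarefree_even_factorization[of "p - 1"] m p(1) odd by auto
  qed
  thus "n = 2 \<or> n = 3 \<or> n = 4 \<or> ?R" by blast
next
  assume "n = 2 \<or> n = 3 \<or> n = 4 \<or> ?R"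
  moreover have ?L if ?R
  proof -
    obtain p and k :: nat and q where p: "n = 2 * p" "prime p" "odd p" and q: "inj_on q {1..k}"
      "\<forall>i\<in>{1..k}. prime (q i) \<and> odd (q i)" and pk: "p - 1 = 2 * (\<Prod>i=1..k. q i)"
      using \<open>?R\<close> by blast
    have "p - 1 = 2 * \<Prod>(q ` {1..k})"
      using pk prod.reindex[OF q(1), of "\<lambda>r. r"] by simp
    moreover obtain b where "balanced_multipliers (2 * \<Prod>(q ` {1..k})) b"
      using ex_balanced_multipliers_prod[of "q ` {1..k}"] q(2) by auto
    moreover obtain g where "primroot_mod_prime p g" using ex_primroot_mod_prime[OF p(2)] ..
    ultimately show ?L
      using primroot_mod_prime.ex_exponential_orthomorphism_twice_prime[of p g b] p by simp
  qed
  ultimately show ?L using small_exponential_orthomorphism by blast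
qed

end
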